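(* Let $q$ be a power of an odd prime, $j\in\mathbb F_q^*$, $S_j=\{x\in\mathbb F_q^d: x_1^2+\cdots+x_d^2=j\}$, $A\subset S_j$ and $B\subset\mathbb F_q^d$. (i) If $j$ is a square in $\mathbb F_q^*$, $d=4k-1$ with $k$ a positive integer, $q\equiv3\pmod4$, and $|A||B|\ge4q^d$, then $|\Delta(A,B)|\ge q/4$. (ii) If $j$ is a non-square in $\mathbb F_q^*$, either $d=4k+1$ ($k$ a positive integer) or ($d=4k-1$ and $q\equiv1\pmod4$), and $|A||B|\ge4q^d$, then $|\Delta(A,B)|\ge q/4$.
   Context: $\|x-y\|=\sum_{i}(x_i-y_i)^2$ and $\Delta(A,B)=\{\|a-b\|:a\in A,b\in B\}$. *)

theory Defs
  imports "HOL-Analysis.Finite_Cartesian_Product" "HOL-Computational_Algebra.Primes"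
begin

definition sqdist :: "'a::comm_ring_1 ^ 'n \<Rightarrow> 'a ^ 'n \<Rightarrow> 'a" where
  "sqdist x y = (\<Sum>i\<in>UNIV. (x $ i - y $ i)^2)"

definition dist_set :: "('a::comm_ring_1 ^ 'n) set \<Rightarrow> ('a ^ 'n) set \<Rightarrow> 'a set" where
  "dist_set A B = {sqdist a b | a b. a \<in> A \<and> b \<in> B}"

definition sphere_ff :: "'a::comm_ring_1 \<Rightarrow> ('a ^ 'n) set" where
  "sphere_ff j = {x. (\<Sum>i\<in>UNIV. (x $ i)^2) = j}"

definition is_square :: "'a::comm_ring_1 \<Rightarrow> bool" where
  "is_square j \<longleftrightarrow> (\<exists>x. x^2 = j)"

end

theory Submission
  imports Defs "HOL-Computational_Algebra.Polynomial" "HOL-Number_Theory.Cong" "HOL-Analysis.Convex"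
begin

text \<open>
  Write \<open>q = CARD('a)\<close>, \<open>d = CARD('n) = 2 D + 1\<close>, and let \<open>\<eta>\<close> be the quadratic character. Gauss sums
  give exact counts for spheres and for their hyperplane sections; the hypotheses of both parts say
  precisely that \<open>\<eta> (-1) ^ D * \<eta> j = -1\<close>, which makes the dominant error term in the count of
  \<open>{a \<in> S\<^sub>j. \<parallel>a - b\<parallel> = \<parallel>a - b'\<parallel>}\<close> negative.
  Let \<open>V\<close> be the sum over \<open>t\<close> of the squared deviation of \<open>\<nu> t = card {(a,b) \<in> A \<times> B. \<parallel>a - b\<parallel> = t}\<close>
  from its mean, and \<open>N = card A * card B\<close>. The Cauchy-Schwarz inequality in \<open>a\<close>, followed by the extension
  of \<open>A\<close> to the whole sphere, yields \<open>V \<le> N q\<^bsup>2D\<^esup> + 2 q\<^bsup>D\<^esup> N (card B) / q\<close>. The same inequality in \<open>b\<close>, followed by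
  the extension of \<open>B\<close> to the whole space, yields \<open>V \<le> N q\<^bsup>2D\<^esup> + 2 q\<^bsup>D\<^esup> N (card A)\<close>. As \<open>N \<ge> 4 q\<^bsup>d\<^esup>\<close>, one of
  the two gives \<open>V \<le> 5 N\<^sup>2 / (4 q)\<close>, and a last application of Cauchy-Schwarz shows that at least
  \<open>4 q / 9\<close> distances occur.
\<close>

section \<open>Additive characters of finite fields\<close>

text \<open>Lets an exponential sum over vectors factor into one-variable sums, one for each
  coordinate.\<close>

lemma sum_prod_vec:
  fixes f :: "'n::finite \<Rightarrow> 'a::finite \<Rightarrow> 'b::comm_semiring_1"
  shows "(\<Sum>x\<in>(UNIV::('a^'n) set). \<Prod>i\<in>UNIV. f i (x $ i)) = (\<Prod>i\<in>UNIV. \<Sum>y\<in>UNIV. f i y)"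
proof -
  have "(\<Prod>i\<in>UNIV. \<Sum>y\<in>UNIV. f i y) = (\<Sum>g\<in>UNIV. \<Prod>i\<in>UNIV. f i (g i))"
    by (subst prod_sum_PiE) auto
  also have "\<dots> = (\<Sum>x\<in>(UNIV::('a^'n) set). \<Prod>i\<in>UNIV. f i (x $ i))"
    by (rule sum.reindex_bij_witness[of _ "\<lambda>x i. x $ i" "\<lambda>g. \<chi> i. g i"]) auto
  finally show ?thesis by simp
qed

text \<open>Adding 1 permutes the ring, so the sum of all elements is unchanged when 1 is added to
  each of them.\<close>

lemma of_nat_CARD_eq_0: "of_nat CARD('a::{ring_1,finite}) = (0::'a)"
proof -
  have "(\<Sum>x\<in>UNIV. x + 1) = (\<Sum>x\<in>UNIV. x::'a)"
    by (rule sum.reindex_bij_witness[of _ "\<lambda>x. x - 1" "\<lambda>x. x + 1"]) auto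
  then show ?thesis by (simp add: sum.distrib)
qed

text \<open>Multiplication by \<open>x\<close> permutes the nonzero elements; compare their product
  before and after.\<close>

lemma power_CARD_minus_1:
  assumes "(x::'a::{field,finite}) \<noteq> 0"
  shows "x ^ (CARD('a) - 1) = 1"
proof -
  let ?P = "\<Prod>y\<in>-{0::'a}. y"
  have "(\<Prod>y\<in>-{0}. x * y) = ?P"
    by (rule prod.reindex_bij_witness[of _ "\<lambda>y. y / x" "\<lambda>y. x * y"]) (use assms in auto)
  then have "x ^ (CARD('a) - 1) * ?P = 1 * ?P"
    by (simp add: prod.distrib card_Diff_singleton Compl_eq_Diff_UNIV)
  moreover have "?P \<noteq> 0" by simp
  ultimately show ?thesis by (metis mult_right_cancel)
qed

lemma power_CARD: "(x::'a::{field,finite}) ^ CARD('a) = x"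
proof (cases "x = 0")
  case False
  have "x ^ Suc (CARD('a) - 1) = x"
    by (simp only: power_Suc power_CARD_minus_1[OF False] mult_1_right)
  moreover have "Suc (CARD('a) - 1) = CARD('a)"
    by (simp add: finite_UNIV_card_ge_0)
  ultimately show ?thesis by simp
qed (simp add: power_0_left)

text \<open>The character is \<open>x \<mapsto> exp (2 \<pi> i T(x) / p)\<close>, where \<open>T\<close> is the trace to the prime field.\<close>

lemma ex_additive_character:
  assumes "prime p" "m > 0" "CARD('a::{field,finite}) = p ^ m"
  shows "\<exists>\<psi> :: 'a \<Rightarrow> complex. (\<forall>x y. \<psi> (x + y) = \<psi> x * \<psi> y) \<and> \<psi> 0 = 1 \<and> (\<exists>x. \<psi> x \<noteq> 1)"
proof -
  have pos: "CHAR('a) > 0"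
    by (rule finite_imp_CHAR_pos) auto
  then have prime_CHAR: "prime CHAR('a)"
    by (rule prime_CHAR_semidom)
  have "CHAR('a) dvd p ^ m"
    using of_nat_CARD_eq_0[where 'a='a] assms(3) by (metis of_nat_eq_0_iff_char_dvd)
  then have p: "p = CHAR('a)"
    using prime_CHAR assms(1) by (metis prime_dvd_power primes_dvd_imp_eq)
  have p1: "p > 1" using assms(1) prime_gt_1_nat by blast
  define T where "T x = (\<Sum>i<m. x ^ p ^ i)" for x :: 'a
  have Tadd: "T (x + y) = T x + T y" for x y
    using prime_CHAR by (simp add: T_def p freshmans_dream' sum.distrib)
  have xq: "x ^ p ^ m = x" for x :: 'a
    using power_CARD[of x] assms(3) by simp
  \<comment> \<open>Raising to the power \<open>p\<close> shifts every exponent by one place, and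
    the last term wraps around because \<open>x ^ p ^ m = x\<close>.\<close>
  have Tfix: "T x ^ p = T x" for x
  proof -
    have "T x ^ p = (\<Sum>i<m. x ^ p ^ Suc i)"
      using prime_CHAR by (simp add: T_def p freshmans_dream_sum power_mult [symmetric] mult.commute)
    moreover have "(\<Sum>i<m. x ^ p ^ Suc i) + x ^ p ^ 0 = (\<Sum>i<Suc m. x ^ p ^ i)"
      by (subst sum.lessThan_Suc_shift) simp
    ultimately show ?thesis using xq[of x] by (simp add: T_def)
  qed
  have inj: "inj_on (of_nat :: nat \<Rightarrow> 'a) {..<p}"
    by (rule inj_onI) (simp add: of_nat_eq_iff_cong_CHAR p cong_def)
  \<comment> \<open>The \<open>p\<close> elements of the prime field are roots of X^p - X, and the
    degree leaves room for no others. Hence \<open>Tfix\<close> places the trace in the prime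
    field.\<close>
  define X where "X = monom 1 p - monom (1::'a) 1"
  have degX: "X \<noteq> 0" "degree X \<le> p"
  proof -
    have "coeff X p = 1" using p1 by (simp add: X_def)
    then show "X \<noteq> 0" by auto
    show "degree X \<le> p"
      using p1 by (auto simp: X_def intro!: degree_diff_le degree_monom_le order.trans[OF degree_monom_le])
  qed
  have sub: "of_nat ` {..<p} \<subseteq> {x::'a. poly X x = 0}"
  proof -
    have "of_nat k ^ p = (of_nat k :: 'a)" for k
      using prime_CHAR p1 by (induction k) (simp_all add: p freshmans_dream)
    then show ?thesis by (auto simp: X_def poly_monom)
  qed
  have "of_nat ` {..<p} = {x::'a. poly X x = 0}"
    by (rule card_seteq[OF _ sub])
       (use card_poly_roots_bound[OF degX(1)] degX(2) in \<open>auto simp: card_image[OF inj]\<close>)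
  then have "\<exists>k. of_nat k = T x" for x
    using Tfix[of x] by (auto simp: X_def poly_monom set_eq_iff image_iff) (metis)
  then obtain k where k: "\<And>x. of_nat (k x) = T x" by metis
  \<comment> \<open>\<open>k x\<close> is an arbitrary natural representative of the trace;
    \<open>per'\<close> below shows that only its residue modulo \<open>p\<close> matters.\<close>
  define \<psi> where "\<psi> x = cis (2 * pi * real (k x) / real p)" for x
  have per: "cis (2 * pi * real a / real p) = cis (2 * pi * real b / real p)"
    if ab: "(of_nat a :: 'a) = of_nat b" and le: "a \<le> b" for a b
  proof -
    from ab have "[a = b] (mod p)" by (simp add: of_nat_eq_iff_cong_CHAR p)
    then have "p dvd b - a" using le by (metis cong_altdef_nat cong_sym)
    then obtain c where "b - a = p * c" by (auto elim: dvdE)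
    then have c: "b = a + p * c" using le by simp
    have "2 * pi * real b / real p = 2 * pi * real a / real p + 2 * pi * real c"
      using p1 unfolding c by (simp add: field_simps)
    then show ?thesis by (simp add: cis_mult [symmetric] cis_multiple_2pi)
  qed
  have per': "cis (2 * pi * real a / real p) = cis (2 * pi * real b / real p)"
    if "(of_nat a :: 'a) = of_nat b" for a b
    using per[of a b] per[of b a] that by (metis nle_le)
  have add: "\<psi> (x + y) = \<psi> x * \<psi> y" for x y
  proof -
    have "\<psi> (x + y) = cis (2 * pi * real (k x + k y) / real p)"
      unfolding \<psi>_def by (rule per') (simp add: k Tadd)
    then show ?thesis by (simp add: \<psi>_def cis_mult add_divide_distrib distrib_left)
  qed
  have zero: "\<psi> 0 = 1"
  proof -
    have "\<psi> 0 = cis (2 * pi * real 0 / real p)"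
      unfolding \<psi>_def by (rule per') (use p1 in \<open>auto simp: k T_def power_0_left\<close>)
    then show ?thesis by simp
  qed
  \<comment> \<open>As a polynomial the trace is nonzero, its linear coefficient being 1, and its
    degree is at most p^(m-1). It cannot vanish at all p^m elements.\<close>
  have "\<exists>x. T x \<noteq> 0"
  proof (rule ccontr)
    assume "\<not> ?thesis"
    then have T0: "T x = 0" for x by blast
    define P where "P = (\<Sum>i<m. monom (1::'a) (p ^ i))"
    have "coeff P 1 = (\<Sum>i<m. if i = 0 then 1 else 0)"
      unfolding P_def coeff_sum using p1 by (intro sum.cong) auto
    then have "P \<noteq> 0" using assms(2) by (auto simp: sum.delta)
    moreover have "{x. poly P x = 0} = UNIV"
      using T0 by (auto simp: P_def T_def poly_sum poly_monom)
    ultimately have "p ^ m \<le> degree P"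
      using card_poly_roots_bound[of P] assms(3) by simp
    moreover have "degree P \<le> p ^ (m - 1)"
      unfolding P_def
      by (intro degree_sum_le order.trans[OF degree_monom_le] power_increasing) (use p1 in auto)
    moreover have "p ^ (m - 1) < p ^ m"
      using p1 assms(2) by (intro power_strict_increasing) auto
    ultimately show False by simp
  qed
  then obtain x where x: "T x \<noteq> 0" by blast
  have "\<psi> x \<noteq> 1"
  proof
    assume "\<psi> x = 1"
    then have "cos (2 * pi * real (k x) / real p) = 1"
      by (simp add: \<psi>_def complex_eq_iff)
    then obtain n :: int where "2 * pi * real (k x) / real p = of_int n * 2 * pi"
      by (auto simp: cos_one_2pi_int)
    then have "real (k x) = of_int n * real p"
      using p1 by (simp add: field_simps)
    then have "of_int (int (k x)) = (of_int (n * int p) :: real)" by simp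
    then have "int (k x) = n * int p" by (simp only: of_int_eq_iff)
    then have "p dvd k x" by (metis dvd_triv_right int_dvd_int_iff)
    then have "of_nat (k x) = (0::'a)" by (simp add: p of_nat_eq_0_iff_char_dvd)
    then show False using x k by metis
  qed
  then show ?thesis using add zero by blast
qed

section \<open>The quadratic character and Gauss sums\<close>

definition quad_char :: "'a::{field,finite} \<Rightarrow> real" where
  "quad_char x = (if x = 0 then 0 else if is_square x then 1 else -1)"

lemma quad_char_0 [simp]: "quad_char 0 = 0"
  by (simp add: quad_char_def)

lemma quad_char_1 [simp]: "quad_char 1 = 1"
  by (auto simp: quad_char_def is_square_def intro: exI[of _ 1])

lemma quad_char_cases: "x \<noteq> 0 \<Longrightarrow> quad_char x = 1 \<or> quad_char x = -1"
  by (auto simp: quad_char_def)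

lemma abs_quad_char_le: "\<bar>quad_char x\<bar> \<le> 1"
  by (auto simp: quad_char_def)

lemma quad_char_mult_square: "c \<noteq> 0 \<Longrightarrow> quad_char (x * c^2) = quad_char x"
proof -
  assume c: "c \<noteq> 0"
  have "is_square (x * c^2) \<longleftrightarrow> is_square x"
  proof
    assume "is_square (x * c^2)"
    then obtain y where "y^2 = x * c^2" by (auto simp: is_square_def)
    then have "(y / c)^2 = x" using c by (simp add: power_divide)
    then show "is_square x" by (auto simp: is_square_def)
  next
    assume "is_square x"
    then obtain y where "y^2 = x" by (auto simp: is_square_def)
    then have "(y * c)^2 = x * c^2" by (simp add: power_mult_distrib)
    then show "is_square (x * c^2)" unfolding is_square_def by blast
  qed
  then show ?thesis using c by (simp add: quad_char_def)
qed

lemma card_roots_sum: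
  fixes f :: "'a::finite \<Rightarrow> 'a"
  shows "(\<Sum>y\<in>UNIV. card {x. f x = y}) = CARD('a)"
proof -
  have "card (\<Union>y. {x. f x = y}) = (\<Sum>y\<in>UNIV. card {x. f x = y})"
    by (rule card_UN_disjoint) auto
  moreover have "(\<Union>y. {x. f x = y}) = UNIV" by auto
  ultimately show ?thesis by simp
qed

lemma square_roots:
  assumes "(y::'a::field)^2 = z"
  shows "{x. x^2 = z} = {y, -y}"
  using assms by (auto simp: power2_eq_iff)

text \<open>The roots \<open>x\<close> and \<open>-x\<close> of a square coincide only at 0, because
  2 is invertible.\<close>

lemma card_square_roots:
  assumes "(2::'a::{field,finite}) \<noteq> 0"
  shows "real (card {x::'a. x^2 = y}) = 1 + quad_char y"
proof (cases "is_square y")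
  case True
  then obtain x where x: "x^2 = y" by (auto simp: is_square_def)
  have "x = -x \<longleftrightarrow> x = 0"
  proof
    assume "x = -x"
    then have "2 * x = 0" by (metis mult_2 add.right_inverse)
    then show "x = 0" using assms by simp
  qed simp
  then have "card {x, -x} = (if y = 0 then 1 else 2)"
    using x by (auto simp: card_insert_if)
  then show ?thesis using x True by (simp add: square_roots[OF x] quad_char_def)
next
  case False
  then have "{x. x^2 = y} = {}" by (auto simp: is_square_def)
  moreover have "y \<noteq> 0" using False by (auto simp: is_square_def)
  ultimately show ?thesis using False by (simp add: quad_char_def)
qed

text \<open>Both summands are at most 2 and they are never both positive away from 0, while the
  sum over all \<open>y\<close> is twice the cardinality of the field.\<close>

lemma card_square_roots_nonsquare:
  assumes two: "(2::'a::{field,finite}) \<noteq> 0" and nonsq: "\<not> is_square (\<nu>::'a)"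
  shows "card {x. x^2 = y} + card {x. \<nu> * x^2 = y} = 2"
proof -
  have \<nu>0: "\<nu> \<noteq> 0" using nonsq by (auto simp: is_square_def)
  define h where "h y = card {x::'a. x^2 = y} + card {x. \<nu> * x^2 = y}" for y
  have le2: "card {x::'a. x^2 = y} \<le> 2" for y
    using card_square_roots[OF two, of y] abs_quad_char_le[of y] by linarith
  have scale: "{x. \<nu> * x^2 = y} = {x. x^2 = y / \<nu>}" for y
    using \<nu>0 by (auto simp: field_simps)
  have h_le: "h y \<le> 2" for y
  proof (cases "y = 0")
    case True
    then show ?thesis by (simp add: h_def \<nu>0)
  next
    case False
    have "{x. x^2 = y} = {} \<or> {x. \<nu> * x^2 = y} = {}"
    proof (rule ccontr)
      assume "\<not> ?thesis"
      then obtain x z where xz: "x^2 = y" "\<nu> * z^2 = y" by blast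
      then have "z \<noteq> 0" using False by auto
      then have "(x / z)^2 = \<nu>" using xz by (simp add: power_divide field_simps)
      then show False using nonsq by (auto simp: is_square_def)
    qed
    then show ?thesis using le2[of y] le2[of "y / \<nu>"] by (auto simp: h_def scale)
  qed
  have "(\<Sum>y\<in>UNIV. h y) = (\<Sum>y::'a\<in>UNIV. 2)"
    by (simp add: h_def sum.distrib card_roots_sum)
  \<comment> \<open>This is subtraction of natural numbers: \<open>h_le\<close> prevents truncation,
    and a vanishing sum of naturals has only zero terms.\<close>
  then have "(\<Sum>y\<in>UNIV. 2 - h y) = 0"
    using h_le by (subst sum_subtractf_nat) auto
  then have "2 - h y = 0" by simp
  then show ?thesis using h_le[of y] by (simp add: h_def)
qed

text \<open>The numbers of square roots of \<open>\<nu> * y\<close> and of \<open>y\<close> add up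
  to 2, and each is 1 plus the character.\<close>

lemma quad_char_mult_nonsquare:
  assumes two: "(2::'a::{field,finite}) \<noteq> 0" and nonsq: "\<not> is_square (\<nu>::'a)"
  shows "quad_char (\<nu> * y) = - quad_char y"
proof -
  have \<nu>0: "\<nu> \<noteq> 0" using nonsq by (auto simp: is_square_def)
  have "{x. \<nu> * x^2 = \<nu> * y} = {x. x^2 = y}" using \<nu>0 by auto
  then have "real (card {x. x^2 = \<nu> * y}) + real (card {x. x^2 = y}) = 2"
    using card_square_roots_nonsquare[OF assms, of "\<nu> * y"] by simp
  then show ?thesis
    using card_square_roots[OF two, of "\<nu> * y"] card_square_roots[OF two, of y] by linarith
qed

lemma quad_char_mult:
  assumes two: "(2::'a::{field,finite}) \<noteq> 0"
  shows "quad_char (x * y :: 'a) = quad_char x * quad_char y"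
proof (cases "x = 0 \<or> is_square x")
  case True
  then show ?thesis
  proof
    assume "is_square x"
    then obtain c where c: "c^2 = x" by (auto simp: is_square_def)
    show ?thesis
    proof (cases "c = 0")
      case False
      then show ?thesis using c quad_char_mult_square[of c y] quad_char_mult_square[of c 1]
        by (simp add: mult.commute)
    qed (use c in auto)
  qed simp
next
  case False
  then show ?thesis
    using quad_char_mult_nonsquare[OF two, of x y] by (simp add: quad_char_def)
qed

text \<open>For q = 4k + 1 a root of -1 is \<open>x ^ k\<close>, where \<open>x ^ (2 * k)\<close> is
  a square root of 1 other than 1. For q = 4k + 3 a root \<open>i\<close> would satisfy i = i^q =
  -i.\<close>

lemma quad_char_uminus_1:
  assumes two: "(2::'a::{field,finite}) \<noteq> 0" and q: "odd CARD('a)"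
  shows "quad_char (-1::'a) = (if CARD('a) mod 4 = 1 then 1 else -1)"
proof (cases "CARD('a) mod 4 = 1")
  case True
  define k where "k = CARD('a) div 4"
  have qk: "CARD('a) = 4 * k + 1"
    using True div_mult_mod_eq[of "CARD('a)" 4] by (simp add: k_def)
  have "k > 0"
    using qk card_mono[of UNIV "{0, 1::'a}"] by (cases k) auto
  \<comment> \<open>Otherwise X^(2k+1) - X would vanish on all 4k + 1 elements, more than its degree
    permits.\<close>
  have "\<exists>x::'a. x \<noteq> 0 \<and> x ^ (2 * k) \<noteq> 1"
  proof (rule ccontr)
    assume contr: "\<not> ?thesis"
    define P where "P = monom (1::'a) (2 * k + 1) - monom 1 1"
    have "coeff P (2 * k + 1) = 1" using \<open>k > 0\<close> by (simp add: P_def)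
    then have "P \<noteq> 0" by auto
    moreover have "poly P x = 0" for x
      using contr by (cases "x = 0") (auto simp: P_def poly_monom)
    then have "{x. poly P x = 0} = UNIV" by auto
    moreover have "degree P \<le> 2 * k + 1"
      unfolding P_def by (intro degree_diff_le order.trans[OF degree_monom_le]) auto
    ultimately show False
      using card_poly_roots_bound[of P] qk \<open>k > 0\<close> by simp
  qed
  then obtain x :: 'a where x: "x \<noteq> 0" "x ^ (2 * k) \<noteq> 1" by blast
  have "(x ^ (2 * k))^2 = 1"
    using power_CARD_minus_1[OF x(1)] qk by (simp add: power_mult [symmetric])
  then have "x ^ (2 * k) = -1"
    using x(2) power2_eq_1_iff by blast
  then have "(x ^ k)^2 = -1"
    by (simp add: power_mult [symmetric] mult.commute)
  then show ?thesis using True by (auto simp: quad_char_def is_square_def)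
next
  case False
  define k where "k = CARD('a) div 4"
  have "CARD('a) mod 4 = 3" using False q by presburger
  then have qk: "CARD('a) = 4 * k + 3"
    using div_mult_mod_eq[of "CARD('a)" 4] by (simp add: k_def)
  have "\<not> is_square (-1::'a)"
  proof
    assume "is_square (-1::'a)"
    then obtain i :: 'a where i: "i^2 = -1" by (auto simp: is_square_def)
    have "CARD('a) = Suc (2 * (2 * k + 1))" using qk by simp
    then have "i ^ CARD('a) = i * (i^2) ^ (2 * k + 1)"
      by (simp only: power_Suc power_mult)
    then have "i = - i" by (simp add: power_CARD i)
    then have "2 * i = 0" by (metis mult_2 add.right_inverse)
    then show False using two i by auto
  qed
  then show ?thesis using False by (simp add: quad_char_def)
qed

section \<open>Character sums and quadratic Gauss sums\<close>

locale additive_character =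
  fixes \<psi> :: "'a::{field,finite} \<Rightarrow> complex"
  assumes psi_add: "\<psi> (x + y) = \<psi> x * \<psi> y"
    and psi_0 [simp]: "\<psi> 0 = 1"
    and psi_nontrivial: "\<exists>x. \<psi> x \<noteq> 1"
    and two_neq_0: "(2::'a) \<noteq> 0"
begin

text \<open>Shifting the variable by \<open>z / a\<close> multiplies the sum by
  \<open>\<psi> z\<close>, which can be chosen different from 1.\<close>

lemma sum_psi: "(\<Sum>x\<in>UNIV. \<psi> (a * x)) = (if a = 0 then of_nat CARD('a) else 0)"
proof (cases "a = 0")
  case False
  obtain z where z: "\<psi> z \<noteq> 1" using psi_nontrivial by blast
  define S where "S = (\<Sum>x\<in>UNIV. \<psi> (a * x))"
  have "S = (\<Sum>x\<in>UNIV. \<psi> (a * (x + z / a)))"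
    unfolding S_def
    by (rule sum.reindex_bij_witness[of _ "\<lambda>x. x + z / a" "\<lambda>x. x - z / a"]) auto
  also have "\<dots> = \<psi> z * S"
    using False by (simp add: S_def distrib_left psi_add sum_distrib_left mult.commute)
  finally have "(\<psi> z - 1) * S = 0" by (simp add: algebra_simps)
  then show ?thesis using z False by (simp add: S_def)
qed simp

definition gauss :: "'a \<Rightarrow> complex" where
  "gauss a = (\<Sum>x\<in>UNIV. \<psi> (a * x^2))"

lemma psi_sum: "finite A \<Longrightarrow> \<psi> (\<Sum>i\<in>A. f i) = (\<Prod>i\<in>A. \<psi> (f i))"
  by (induction A rule: finite_induct) (simp_all add: psi_add)

lemma sum_comp_eq_sum_card:
  fixes f :: "'a \<Rightarrow> 'a" and g :: "'a \<Rightarrow> complex"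
  shows "(\<Sum>x\<in>UNIV. g (f x)) = (\<Sum>y\<in>UNIV. of_nat (card {x. f x = y}) * g y)"
proof -
  have "(\<Sum>x\<in>UNIV. g (f x)) = (\<Sum>y\<in>UNIV. \<Sum>x\<in>{x \<in> UNIV. f x = y}. g (f x))"
    by (rule sum.group [symmetric]) auto
  then show ?thesis by simp
qed

text \<open>The values \<open>x^2\<close> and \<open>\<nu> * x^2\<close> together hit every field
  element exactly twice, so the two Gauss sums add up to twice a full character sum, which is
  0.\<close>

lemma gauss_nonsquare:
  assumes "a \<noteq> 0" "\<not> is_square \<nu>"
  shows "gauss (a * \<nu>) = - gauss a"
proof -
  have "gauss a + gauss (a * \<nu>) = (\<Sum>y\<in>UNIV. of_nat (card {x. x^2 = y} + card {x. \<nu> * x^2 = y}) * \<psi> (a * y))"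
    using sum_comp_eq_sum_card[of "\<lambda>y. \<psi> (a * y)" "\<lambda>x. x^2"]
      sum_comp_eq_sum_card[of "\<lambda>y. \<psi> (a * y)" "\<lambda>x. \<nu> * x^2"]
    by (simp add: gauss_def mult.assoc distrib_right sum.distrib)
  also have "\<dots> = 0"
    using assms(1)
    by (simp add: card_square_roots_nonsquare[OF two_neq_0 assms(2)] sum_distrib_left [symmetric] sum_psi)
  finally show ?thesis by (simp add: eq_neg_iff_add_eq_0 add.commute)
qed

text \<open>If \<open>-ab\<close> is a square, \<open>a x\<^sup>2 + b y\<^sup>2\<close> splits into linear factors.\<close>

lemma gauss_mult_square:
  assumes "a \<noteq> 0" "b \<noteq> 0" "- (a * b) = c^2"
  shows "gauss a * gauss b = of_nat CARD('a)"
proof -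
  have c: "c \<noteq> 0" using assms by auto
  have b: "b = - (c^2) / a" using assms by (simp add: field_simps flip: assms(3))
  have "gauss a * gauss b = (\<Sum>x\<in>UNIV. \<Sum>y\<in>UNIV. \<psi> (a * x^2 + b * y^2))"
    by (simp add: gauss_def sum_product psi_add)
  \<comment> \<open>For fixed \<open>x\<close>, substitute z = c y / a + x. The exponent becomes
    linear in \<open>x\<close>, so that summing over \<open>x\<close> leaves only z = 0.\<close>
  also have "\<dots> = (\<Sum>x\<in>UNIV. \<Sum>z\<in>UNIV. \<psi> (- (a * z^2) + (2 * a * z) * x))"
  proof (rule sum.cong [OF refl])
    fix x
    have eq: "- (a * (c * y / a + x)^2) + (2 * a * (c * y / a + x)) * x = a * x^2 + b * y^2" for y
    proof -
      define h where "h = c * y / a"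
      have "b * y^2 = - (a * h^2)"
        using assms(1) by (simp add: b h_def power2_eq_square)
      then show ?thesis
        unfolding h_def [symmetric] by (simp add: power2_eq_square algebra_simps)
    qed
    show "(\<Sum>y\<in>UNIV. \<psi> (a * x^2 + b * y^2)) = (\<Sum>z\<in>UNIV. \<psi> (- (a * z^2) + (2 * a * z) * x))"
      by (rule sum.reindex_bij_witness[of _ "\<lambda>z. a * (z - x) / c" "\<lambda>y. c * y / a + x"])
         (simp_all only: eq, use assms(1) c in simp_all)
  qed
  also have "\<dots> = (\<Sum>z\<in>UNIV. \<psi> (- (a * z^2)) * (\<Sum>x\<in>UNIV. \<psi> ((2 * a * z) * x)))"
    by (subst sum.swap) (simp only: psi_add sum_distrib_left)
  also have "\<dots> = (\<Sum>z\<in>(UNIV::'a set). if z = 0 then of_nat CARD('a) else 0)"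
    by (intro sum.cong refl) (simp add: sum_psi assms(1) two_neq_0)
  also have "\<dots> = of_nat CARD('a)" by simp
  finally show ?thesis .
qed

text \<open>If \<open>-ab\<close> is a nonsquare \<open>\<nu>\<close>, then \<open>-ab\<nu>\<close> is a square.\<close>

lemma gauss_mult:
  assumes "a \<noteq> 0" "b \<noteq> 0"
  shows "gauss a * gauss b = of_real (quad_char (- (a * b))) * of_nat CARD('a)"
proof (cases "is_square (- (a * b))")
  case True
  then obtain c where c: "- (a * b) = c^2" unfolding is_square_def by metis
  have "quad_char (- (a * b)) = 1" using assms True by (simp add: quad_char_def)
  then show ?thesis using gauss_mult_square[OF assms c] by simp
next
  case False
  let ?\<nu> = "- (a * b)"
  have "gauss a * gauss (b * ?\<nu>) = of_nat CARD('a)"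
    by (rule gauss_mult_square[where c = "a * b"]) (use assms in \<open>auto simp: power2_eq_square\<close>)
  then show ?thesis
    using gauss_nonsquare[OF assms(2) False] assms False
    by (simp add: quad_char_def minus_equation_iff)
qed

text \<open>The square of a Gauss sum is \<open>quad_char (-1)\<close> times q, so in odd dimension
  a single Gauss sum survives.\<close>

lemma gauss_power_odd:
  assumes "a \<noteq> 0"
  shows "gauss a ^ (2 * D + 1) = of_real (quad_char (-1::'a) * CARD('a)) ^ D * gauss a"
proof -
  have "gauss a ^ 2 = of_real (quad_char (- (a * a))) * of_nat CARD('a)"
    using gauss_mult[OF assms assms] by (simp add: power2_eq_square)
  also have "quad_char (- (a * a)) = quad_char (-1::'a)"
    using quad_char_mult_square[OF assms, of "-1"] by (simp add: power2_eq_square)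
  finally show ?thesis by (simp add: power_mult)
qed

text \<open>Over all frequencies the sum is q times the number of square roots of \<open>t\<close>,
  that is, q (1 + \<open>quad_char t\<close>). The frequency 0 accounts for the q that is
  removed.\<close>

lemma sum_gauss_psi:
  "(\<Sum>a\<in>UNIV-{0}. gauss a * \<psi> (- (a * t))) = of_nat CARD('a) * of_real (quad_char t)"
proof -
  have "(\<Sum>a\<in>UNIV. gauss a * \<psi> (- (a * t))) = (\<Sum>a\<in>UNIV. \<Sum>x\<in>UNIV. \<psi> ((x^2 - t) * a))"
    by (simp add: gauss_def sum_distrib_left sum_distrib_right psi_add [symmetric] right_diff_distrib mult.commute)
  also have "\<dots> = (\<Sum>x\<in>UNIV. \<Sum>a\<in>UNIV. \<psi> ((x^2 - t) * a))"
    by (rule sum.swap)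
  also have "\<dots> = of_nat (card {x. x^2 = t}) * of_nat CARD('a)"
    by (simp add: sum_psi sum.If_cases)
  also have "of_nat (card {x. x^2 = t}) = complex_of_real (1 + quad_char t)"
    by (metis card_square_roots[OF two_neq_0] of_real_of_nat_eq)
  finally show ?thesis
    by (simp add: sum_diff1 gauss_def algebra_simps)
qed

text \<open>Complete the square and translate the variable.\<close>

lemma sum_psi_quadratic:
  assumes "a \<noteq> 0"
  shows "(\<Sum>x\<in>UNIV. \<psi> (a * x^2 + b * x)) = gauss a * \<psi> (- (b^2 / (4 * a)))"
proof -
  have sq: "a * (x + b / (2 * a))^2 + - (b^2 / (4 * a)) = a * x^2 + b * x" for x
  proof -
    define h where "h = b / (2 * a)"
    have b: "b = 2 * a * h" using assms two_neq_0 by (simp add: h_def)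
    have "4 * a \<noteq> 0"
      using assms two_neq_0 by (metis mult_2 mult_eq_0_iff numeral_Bit0)
    then have h2: "b^2 / (4 * a) = a * h^2"
      unfolding b by (subst divide_eq_eq) (simp add: power2_eq_square)
    have "a * (x + h)^2 + - (a * h^2) = a * x^2 + b * x"
      unfolding b power2_eq_square by (simp add: algebra_simps)
    then show ?thesis by (simp only: h2 h_def [symmetric])
  qed
  have "(\<Sum>x\<in>UNIV. \<psi> (a * x^2 + b * x)) = (\<Sum>x\<in>UNIV. \<psi> (a * x^2 + - (b^2 / (4 * a))))"
    by (rule sum.reindex_bij_witness[of _ "\<lambda>x. x - b / (2 * a)" "\<lambda>x. x + b / (2 * a)"])
       (simp_all add: sq del: minus_divide_left add_uminus_conv_diff)
  also have "\<dots> = gauss a * \<psi> (- (b^2 / (4 * a)))"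
    unfolding gauss_def sum_distrib_right by (simp only: psi_add)
  finally show ?thesis .
qed

end

section \<open>Spheres and their hyperplane sections\<close>

definition normsq :: "'a::comm_ring_1 ^ 'n \<Rightarrow> 'a" where
  "normsq x = (\<Sum>i\<in>UNIV. (x $ i)^2)"

definition dotp :: "'a::comm_ring_1 ^ 'n \<Rightarrow> 'a ^ 'n \<Rightarrow> 'a" where
  "dotp u x = (\<Sum>i\<in>UNIV. u $ i * x $ i)"

context additive_character
begin

lemma sum_psi_vec:
  fixes u :: "'a ^ 'n"
  assumes "a \<noteq> 0"
  shows "(\<Sum>x\<in>UNIV. \<psi> (a * normsq x + b * dotp u x))
    = gauss a ^ CARD('n) * \<psi> (- (b^2 * normsq u / (4 * a)))"
proof -
  have "(\<Sum>x\<in>UNIV. \<psi> (a * normsq x + b * dotp u x))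
      = (\<Sum>x\<in>UNIV. \<Prod>i\<in>UNIV. \<psi> (a * (x $ i)^2 + b * u $ i * x $ i))"
    unfolding psi_sum [OF finite, symmetric]
    by (simp add: normsq_def dotp_def sum_distrib_left sum.distrib mult.assoc)
  also have "\<dots> = (\<Prod>i\<in>UNIV. gauss a * \<psi> (- ((b * u $ i)^2 / (4 * a))))"
    by (subst sum_prod_vec) (simp only: sum_psi_quadratic[OF assms])
  also have "\<dots> = gauss a ^ CARD('n) * \<psi> (\<Sum>i\<in>UNIV. - ((b * u $ i)^2 / (4 * a)))"
    by (simp add: prod.distrib psi_sum)
  also have "(\<Sum>i\<in>UNIV. - ((b * u $ i)^2 / (4 * a))) = - (b^2 * normsq u / (4 * a))"
    by (simp add: normsq_def sum_negf sum_divide_distrib sum_distrib_left power_mult_distrib)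
  finally show ?thesis .
qed

lemma sum_psi_dotp:
  fixes u :: "'a ^ 'n"
  assumes "u \<noteq> 0"
  shows "(\<Sum>x\<in>UNIV. \<psi> (b * dotp u x)) = (if b = 0 then of_nat CARD('a) ^ CARD('n) else 0)"
proof (cases "b = 0")
  case False
  obtain i where "u $ i \<noteq> 0" using assms by (auto simp: vec_eq_iff)
  then have zero: "(\<Sum>y\<in>UNIV. \<psi> (b * u $ i * y)) = 0"
    using False by (simp add: sum_psi)
  have "(\<Sum>x\<in>UNIV. \<psi> (b * dotp u x)) = (\<Sum>x\<in>UNIV. \<Prod>i\<in>UNIV. \<psi> (b * u $ i * x $ i))"
    unfolding psi_sum [OF finite, symmetric]
    by (simp add: dotp_def sum_distrib_left mult.assoc)
  also have "\<dots> = 0"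
    by (subst sum_prod_vec) (use zero in \<open>auto intro!: prod_zero\<close>)
  finally show ?thesis using False by simp
qed (simp add: CARD_vec)

section \<open>Counting solutions of equations by orthogonality of characters\<close>

text \<open>By \<open>sum_psi\<close>, summing \<open>\<psi> ((f x - t) * a)\<close> over
  \<open>a\<close> gives q if \<open>f x = t\<close> and 0 otherwise.\<close>

lemma card_eq_sum_psi:
  fixes f :: "'b::finite \<Rightarrow> 'a"
  shows "of_nat CARD('a) * of_nat (card {x. f x = t})
    = (\<Sum>a\<in>UNIV. \<psi> (- (a * t)) * (\<Sum>x\<in>UNIV. \<psi> (a * f x)))"
proof -
  have "(\<Sum>a\<in>UNIV. \<psi> (- (a * t)) * (\<Sum>x\<in>UNIV. \<psi> (a * f x)))
      = (\<Sum>x\<in>UNIV. \<Sum>a\<in>UNIV. \<psi> ((f x - t) * a))"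
    by (subst sum.swap) (simp add: sum_distrib_left psi_add [symmetric] algebra_simps)
  also have "\<dots> = (\<Sum>x\<in>UNIV. if f x = t then of_nat CARD('a) else 0)"
    by (rule sum.cong [OF refl]) (simp add: sum_psi)
  also have "\<dots> = of_nat CARD('a) * of_nat (card {x. f x = t})"
    by (simp add: sum.If_cases mult.commute)
  finally show ?thesis by simp
qed

lemma card_eq_sum_psi2:
  fixes f g :: "'b::finite \<Rightarrow> 'a"
  shows "of_nat CARD('a) ^ 2 * of_nat (card {x. f x = t \<and> g x = s})
    = (\<Sum>a\<in>UNIV. \<Sum>b\<in>UNIV. \<psi> (- (a * t)) * \<psi> (- (b * s)) * (\<Sum>x\<in>UNIV. \<psi> (a * f x + b * g x)))"
proof -
  have "(\<Sum>a\<in>UNIV. \<Sum>b\<in>UNIV. \<psi> (- (a * t)) * \<psi> (- (b * s)) * (\<Sum>x\<in>UNIV. \<psi> (a * f x + b * g x)))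
      = (\<Sum>a\<in>UNIV. \<Sum>b\<in>UNIV. \<Sum>x\<in>UNIV. \<psi> ((f x - t) * a) * \<psi> ((g x - s) * b))"
    by (simp add: sum_distrib_left psi_add [symmetric] algebra_simps)
  also have "\<dots> = (\<Sum>a\<in>UNIV. \<Sum>x\<in>UNIV. \<Sum>b\<in>UNIV. \<psi> ((f x - t) * a) * \<psi> ((g x - s) * b))"
    by (rule sum.cong [OF refl]) (rule sum.swap)
  also have "\<dots> = (\<Sum>x\<in>UNIV. \<Sum>a\<in>UNIV. \<Sum>b\<in>UNIV. \<psi> ((f x - t) * a) * \<psi> ((g x - s) * b))"
    by (rule sum.swap)
  also have "\<dots> = (\<Sum>x\<in>UNIV. (\<Sum>a\<in>UNIV. \<psi> ((f x - t) * a)) * (\<Sum>b\<in>UNIV. \<psi> ((g x - s) * b)))"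
    by (simp add: sum_product)
  also have "\<dots> = (\<Sum>x\<in>UNIV. if f x = t \<and> g x = s then of_nat CARD('a) ^ 2 else 0)"
    by (rule sum.cong [OF refl]) (simp add: sum_psi power2_eq_square)
  also have "\<dots> = of_nat CARD('a) ^ 2 * of_nat (card {x. f x = t \<and> g x = s})"
    by (simp add: sum.If_cases mult.commute)
  finally show ?thesis by simp
qed

text \<open>Frequency 0 gives the main term. At the others the Gauss sum to the power 2D + 1
  collapses to a constant times one Gauss sum, and \<open>sum_gauss_psi\<close> evaluates the sum
  over frequencies.\<close>

lemma card_sphere:
  assumes n: "CARD('n::finite) = 2 * D + 1"
  shows "real (card {x::'a^'n. normsq x = t})
    = real CARD('a) ^ (2 * D) + (quad_char (-1::'a) * CARD('a)) ^ D * quad_char t"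
proof -
  let ?q = "of_nat CARD('a) :: complex" and ?C = "of_real (quad_char (-1::'a) * CARD('a)) ^ D :: complex"
  have "?q * of_nat (card {x::'a^'n. normsq x = t})
      = (\<Sum>a\<in>UNIV. \<psi> (- (a * t)) * (\<Sum>x\<in>UNIV. \<psi> (a * normsq (x::'a^'n))))"
    by (rule card_eq_sum_psi)
  also have "\<dots> = ?q ^ CARD('n) + (\<Sum>a\<in>UNIV-{0}. \<psi> (- (a * t)) * (\<Sum>x\<in>UNIV. \<psi> (a * normsq (x::'a^'n))))"
    by (subst sum.remove[of _ 0]) (simp_all add: CARD_vec)
  also have "(\<Sum>a\<in>UNIV-{0}. \<psi> (- (a * t)) * (\<Sum>x\<in>UNIV. \<psi> (a * normsq (x::'a^'n))))
      = (\<Sum>a\<in>UNIV-{0}. ?C * (gauss a * \<psi> (- (a * t))))"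
  proof (rule sum.cong [OF refl])
    fix a :: 'a assume "a \<in> UNIV - {0}"
    then have a: "a \<noteq> 0" by simp
    show "\<psi> (- (a * t)) * (\<Sum>x\<in>UNIV. \<psi> (a * normsq (x::'a^'n))) = ?C * (gauss a * \<psi> (- (a * t)))"
      using sum_psi_vec[OF a, of 0 "0::'a^'n"] gauss_power_odd[OF a, of D] by (simp add: n)
  qed
  also have "\<dots> = ?C * (?q * of_real (quad_char t))"
    by (simp only: sum_distrib_left [symmetric] sum_gauss_psi)
  also have "?q ^ CARD('n) = ?q * ?q ^ (2 * D)"
    by (simp add: n)
  finally have "?q * of_nat (card {x::'a^'n. normsq x = t}) = ?q * (?q ^ (2 * D) + ?C * of_real (quad_char t))"
    by (simp add: algebra_simps)
  then have "complex_of_real (real (card {x::'a^'n. normsq x = t}))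
    = complex_of_real (real CARD('a) ^ (2 * D) + (quad_char (-1::'a) * CARD('a)) ^ D * quad_char t)"
    by simp
  then show ?thesis by (simp only: of_real_eq_iff)
qed

text \<open>The frequencies with a = 0 give only the main term. For the others the sum over
  \<open>b\<close> is linear if \<open>u\<close> is isotropic, and otherwise produces a second Gauss
  sum whose product with the first is explicit by \<open>gauss_mult\<close>.\<close>

lemma card_sphere_hyperplane:
  fixes u :: "'a ^ 'n"
  assumes n: "CARD('n) = 2 * D + 1" and u: "u \<noteq> 0"
  shows "real CARD('a) * real (card {x. normsq x = t \<and> dotp u x = s})
    = real CARD('a) ^ (2 * D) + (quad_char (-1::'a) * CARD('a)) ^ D *
      (if normsq u = 0 then if s = 0 then real CARD('a) * quad_char t else 0
       else quad_char (normsq u) * ((if s^2 = normsq u * t then real CARD('a) else 0) - 1))"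
proof -
  let ?q = "of_nat CARD('a) :: complex" and ?C = "of_real (quad_char (-1::'a) * CARD('a)) ^ D :: complex"
  define m where "m = normsq u"
  define R where "R = (if m = 0 then if s = 0 then real CARD('a) * quad_char t else 0
       else quad_char m * ((if s^2 = m * t then real CARD('a) else 0) - 1))"
  define F where "F a b = \<psi> (- (a * t)) * \<psi> (- (b * s)) * (\<Sum>x\<in>UNIV. \<psi> (a * normsq x + b * dotp u x))" for a b
  have F0: "(\<Sum>b\<in>UNIV. F 0 b) = ?q ^ CARD('n)"
  proof -
    have "F 0 b = (if b = 0 then ?q ^ CARD('n) else 0)" for b
      by (simp add: F_def sum_psi_dotp[OF u])
    then show ?thesis by simp
  qed
  have Fa: "F a b = ?C * gauss a * \<psi> (- (a * t)) * \<psi> (- (m / (4 * a)) * b^2 + - s * b)" if "a \<noteq> 0" for a b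
  proof -
    have "\<psi> (- (m / (4 * a)) * b^2 + - s * b) = \<psi> (- (b^2 * m / (4 * a))) * \<psi> (- (b * s))"
      by (simp add: psi_add [symmetric] algebra_simps)
    moreover have "gauss a ^ CARD('n) = ?C * gauss a"
      using gauss_power_odd[OF that, of D] by (simp only: n)
    ultimately show ?thesis
      unfolding F_def m_def sum_psi_vec[OF that] by (simp only: mult_ac)
  qed
  have F1: "(\<Sum>a\<in>UNIV-{0}. \<Sum>b\<in>UNIV. F a b) = ?C * ?q * of_real R"
  proof (cases "m = 0")
    case True
    have sum_b: "(\<Sum>b\<in>UNIV. \<psi> (- s * b)) = (if s = 0 then ?q else 0)"
      by (simp only: sum_psi neg_equal_0_iff_equal)
    have "(\<Sum>a\<in>UNIV-{0}. \<Sum>b\<in>UNIV. F a b)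
        = (\<Sum>a\<in>UNIV-{0}. ?C * (if s = 0 then ?q else 0) * (gauss a * \<psi> (- (a * t))))"
    proof (rule sum.cong [OF refl])
      fix a :: 'a assume "a \<in> UNIV - {0}"
      then have a: "a \<noteq> 0" by simp
      have "(\<Sum>b\<in>UNIV. F a b) = ?C * gauss a * \<psi> (- (a * t)) * (\<Sum>b\<in>UNIV. \<psi> (- s * b))"
        by (simp add: Fa[OF a] True sum_distrib_left)
      then show "(\<Sum>b\<in>UNIV. F a b) = ?C * (if s = 0 then ?q else 0) * (gauss a * \<psi> (- (a * t)))"
        by (simp only: sum_b) simp
    qed
    also have "\<dots> = ?C * ?q * of_real R"
      by (simp only: sum_distrib_left [symmetric] sum_gauss_psi) (simp add: R_def True)
    finally show ?thesis .
  next
    case False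
    have four: "(4::'a) \<noteq> 0"
      using two_neq_0 by (metis mult_2 mult_eq_0_iff numeral_Bit0)
    have "(\<Sum>a\<in>UNIV-{0}. \<Sum>b\<in>UNIV. F a b)
        = (\<Sum>a\<in>UNIV-{0}. ?C * ?q * of_real (quad_char m) * \<psi> ((s^2 / m - t) * a))"
    proof (rule sum.cong [OF refl])
      fix a :: 'a assume "a \<in> UNIV - {0}"
      then have a: "a \<noteq> 0" by simp
      let ?c = "- (m / (4 * a))"
      have c: "?c \<noteq> 0" using a False four by simp
      \<comment> \<open>The product -a c equals m / 4, and the square factor 1/4 does not affect the
        character.\<close>
      have "quad_char (- (a * ?c)) = quad_char (m * (1 / 2)^2)"
        using a four by (simp add: power2_eq_square)
      also have "\<dots> = quad_char m"
        using two_neq_0 by (intro quad_char_mult_square) simp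
      finally have gg: "gauss a * gauss ?c = of_real (quad_char m) * ?q"
        using gauss_mult[OF a c] by simp
      have arg: "- ((- s)^2 / (4 * ?c)) = s^2 / m * a"
        using a False four by simp
      have "(\<Sum>b\<in>UNIV. F a b) = ?C * gauss a * \<psi> (- (a * t)) * (\<Sum>b\<in>UNIV. \<psi> (?c * b^2 + - s * b))"
        by (simp only: Fa[OF a] sum_distrib_left)
      also have "(\<Sum>b\<in>UNIV. \<psi> (?c * b^2 + - s * b)) = gauss ?c * \<psi> (s^2 / m * a)"
        by (simp only: sum_psi_quadratic[OF c] arg)
      also have "?C * gauss a * \<psi> (- (a * t)) * (gauss ?c * \<psi> (s^2 / m * a))
          = ?C * (gauss a * gauss ?c) * (\<psi> (s^2 / m * a) * \<psi> (- (a * t)))"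
        by (simp only: mult_ac)
      also have "\<psi> (s^2 / m * a) * \<psi> (- (a * t)) = \<psi> ((s^2 / m - t) * a)"
        by (simp add: psi_add [symmetric] algebra_simps)
      finally show "(\<Sum>b\<in>UNIV. F a b) = ?C * ?q * of_real (quad_char m) * \<psi> ((s^2 / m - t) * a)"
        unfolding gg by (simp only: mult_ac)
    qed
    \<comment> \<open>Restoring the frequency a = 0 costs 1 and yields a full character sum, which
      detects s^2 = m t.\<close>
    also have "\<dots> = ?C * ?q * of_real (quad_char m) * ((\<Sum>a\<in>UNIV. \<psi> ((s^2 / m - t) * a)) - 1)"
      by (simp only: sum_distrib_left [symmetric]) (simp add: sum_diff1)
    also have "(\<Sum>a\<in>UNIV. \<psi> ((s^2 / m - t) * a)) = (if s^2 = m * t then ?q else 0)"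
      using False by (simp only: sum_psi) (simp add: field_simps)
    finally show ?thesis
      using False by (simp add: R_def)
  qed
  have "?q ^ 2 * of_nat (card {x. normsq x = t \<and> dotp u x = s}) = (\<Sum>a\<in>UNIV. \<Sum>b\<in>UNIV. F a b)"
    unfolding F_def by (rule card_eq_sum_psi2)
  also have "\<dots> = ?q ^ CARD('n) + ?C * ?q * of_real R"
    by (subst sum.remove[of _ 0]) (simp_all add: F0 F1)
  also have "\<dots> = ?q * (?q ^ (2 * D) + ?C * of_real R)"
    by (simp add: n algebra_simps)
  finally have "?q * (?q * of_nat (card {x. normsq x = t \<and> dotp u x = s})) = ?q * (?q ^ (2 * D) + ?C * of_real R)"
    by (simp add: power2_eq_square mult.assoc)
  then have "?q * of_nat (card {x. normsq x = t \<and> dotp u x = s}) = ?q ^ (2 * D) + ?C * of_real R"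
    by simp
  then have "complex_of_real (real CARD('a) * real (card {x. normsq x = t \<and> dotp u x = s}))
    = complex_of_real (real CARD('a) ^ (2 * D) + (quad_char (-1::'a) * CARD('a)) ^ D * R)"
    by simp
  then show ?thesis
    unfolding R_def m_def by (simp only: of_real_eq_iff)
qed

end

section \<open>Second moment of the distance count\<close>

lemma sphere_ff_eq_normsq: "sphere_ff t = {x. normsq x = t}"
  by (simp add: sphere_ff_def normsq_def)

lemma sqdist_eq_normsq: "sqdist x y = normsq (x - y)"
  by (simp add: sqdist_def normsq_def)

lemma normsq_diff: "normsq (x - y) = normsq x + normsq y - 2 * dotp y x"
  by (simp add: normsq_def dotp_def power2_diff sum.distrib sum_subtractf sum_distrib_left mult_ac)

lemma dotp_diff: "dotp (x - y) z = dotp x z - dotp y z"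
  by (simp add: dotp_def left_diff_distrib sum_subtractf)

section \<open>Fibre counts and quadratic inequalities for them\<close>

lemma sum_squared_le_card:
  fixes f :: "'b \<Rightarrow> real"
  shows "(\<Sum>i\<in>I. f i)^2 \<le> real (card I) * (\<Sum>i\<in>I. (f i)^2)"
  using Cauchy_Schwarz_ineq_sum[of f "\<lambda>_. 1" I] by (simp add: mult.commute)

text \<open>The index set is generic: the count is applied to \<open>A \<times> B\<close> with the
  distance, to \<open>B\<close> with the distance from a fixed point, and to the whole space with a
  pair of norms.\<close>

definition fiber_count :: "'b set \<Rightarrow> ('b \<Rightarrow> 'a) \<Rightarrow> 'a \<Rightarrow> real" where
  "fiber_count B f t = real (card {b\<in>B. f b = t})"

lemma fiber_count_eq_sum: "finite B \<Longrightarrow> fiber_count B f t = (\<Sum>b\<in>B. of_bool (f b = t))"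
  by (simp add: fiber_count_def of_bool_def sum.If_cases Int_def)

lemma fiber_count_Times:
  assumes "finite A" "finite B"
  shows "fiber_count (A \<times> B) (\<lambda>(a,b). g a b) t = (\<Sum>a\<in>A. fiber_count B (g a) t)"
  unfolding fiber_count_eq_sum[OF finite_cartesian_product[OF assms]] fiber_count_eq_sum[OF assms(2)]
    sum.cartesian_product
  by (intro sum.cong refl) (auto split: prod.split)

text \<open>Combines a uniform bound \<open>k\<close> on all pairs with an extra allowance
  \<open>l\<close> on the diagonal.\<close>

lemma sum_sum_diagonal:
  fixes k l :: real
  assumes "finite A"
  shows "(\<Sum>a\<in>A. \<Sum>a'\<in>A. k + of_bool (a' = a) * l) = real (card A)^2 * k + real (card A) * l"
proof -
  have "(\<Sum>a'\<in>A. of_bool (a' = a) * l) = l" if "a \<in> A" for a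
  proof -
    have "(\<Sum>a'\<in>A. of_bool (a' = a) * l) = (\<Sum>a'\<in>A. if a' = a then l else 0)"
      by (intro sum.cong) auto
    then show ?thesis using assms that by simp
  qed
  then show ?thesis by (simp add: sum.distrib power2_eq_square algebra_simps)
qed

lemma sum_comp_fiber_count:
  fixes f :: "'b \<Rightarrow> 'a::finite" and w :: "'a \<Rightarrow> real"
  assumes "finite B"
  shows "(\<Sum>b\<in>B. w (f b)) = (\<Sum>t\<in>UNIV. w t * fiber_count B f t)"
proof -
  have "(\<Sum>b\<in>B. w (f b)) = (\<Sum>t\<in>UNIV. \<Sum>b\<in>{b\<in>B. f b = t}. w (f b))"
    using assms by (intro sum.group [symmetric]) auto
  then show ?thesis by (simp add: fiber_count_def mult.commute)
qed

lemma sum_fiber_count: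
  fixes f :: "'b \<Rightarrow> 'a::finite"
  assumes "finite B"
  shows "(\<Sum>t\<in>UNIV. fiber_count B f t) = real (card B)"
  using sum_comp_fiber_count[OF assms, of "\<lambda>_. 1" f] by simp

lemma sum_fiber_count_sq:
  fixes f :: "'b \<Rightarrow> 'a::finite"
  assumes "finite B"
  shows "(\<Sum>t\<in>UNIV. (fiber_count B f t)^2) = (\<Sum>b\<in>B. \<Sum>b'\<in>B. of_bool (f b' = f b))"
  using sum_comp_fiber_count[OF assms, of "fiber_count B f" f]
  by (simp add: power2_eq_square fiber_count_eq_sum[OF assms])

lemma sum_fiber_count_deviation_sq:
  fixes f :: "'b \<Rightarrow> 'a::finite"
  assumes "finite B"
  shows "(\<Sum>t\<in>UNIV. (fiber_count B f t - card B / CARD('a))^2)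
    = (\<Sum>t\<in>UNIV. (fiber_count B f t)^2) - (card B)^2 / CARD('a)"
proof -
  define c where "c = real (card B) / CARD('a)"
  have "(\<Sum>t\<in>UNIV. (fiber_count B f t - c)^2)
      = (\<Sum>t\<in>UNIV. (fiber_count B f t)^2) + CARD('a) * c^2 - 2 * c * (\<Sum>t\<in>UNIV. fiber_count B f t)"
    by (simp add: power2_diff sum.distrib sum_subtractf sum_distrib_left mult_ac)
  also have "\<dots> = (\<Sum>t\<in>UNIV. (fiber_count B f t)^2) - (card B)^2 / CARD('a)"
    by (simp add: sum_fiber_count[OF assms] c_def power2_eq_square field_simps)
  finally show ?thesis by (simp add: c_def)
qed

text \<open>A Schur test: bound the product of two weights by half the sum of their squares.
  Symmetry makes the two halves equal, and each row has at most \<open>k\<close> entries.\<close>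

lemma sum_symmetric_kernel_le:
  fixes w :: "'a::finite \<Rightarrow> real"
  assumes sym: "\<And>s t. P s t \<Longrightarrow> P t s" and card: "\<And>s. real (card {t. P s t}) \<le> k"
  shows "\<bar>\<Sum>s\<in>UNIV. \<Sum>t\<in>UNIV. w s * w t * of_bool (P s t)\<bar> \<le> k * (\<Sum>t\<in>UNIV. (w t)^2)"
proof -
  have half: "(\<Sum>s\<in>UNIV. \<Sum>t\<in>UNIV. (w s)^2 * of_bool (P s t)) \<le> k * (\<Sum>t\<in>UNIV. (w t)^2)"
  proof -
    have "(\<Sum>t\<in>UNIV. (w s)^2 * of_bool (P s t)) \<le> k * (w s)^2" for s
    proof -
      have "(\<Sum>t\<in>UNIV. (w s)^2 * of_bool (P s t)) = real (card {t. P s t}) * (w s)^2"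
        unfolding sum_distrib_left [symmetric] by (simp add: of_bool_def sum.If_cases)
      then show ?thesis using mult_right_mono[OF card[of s], of "(w s)^2"] by simp
    qed
    then show ?thesis unfolding sum_distrib_left by (rule sum_mono)
  qed
  have swap: "(\<Sum>s\<in>UNIV. \<Sum>t\<in>UNIV. (w t)^2 * of_bool (P s t)) = (\<Sum>s\<in>UNIV. \<Sum>t\<in>UNIV. (w s)^2 * of_bool (P s t))"
  proof -
    have "P s t = P t s" for s t using sym by blast
    then show ?thesis by (subst sum.swap) simp
  qed
  have "\<bar>\<Sum>s\<in>UNIV. \<Sum>t\<in>UNIV. w s * w t * of_bool (P s t)\<bar>
      \<le> (\<Sum>s\<in>UNIV. \<Sum>t\<in>UNIV. \<bar>w s * w t * of_bool (P s t)\<bar>)"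
    by (intro order.trans[OF sum_abs] sum_mono sum_abs)
  also have "\<dots> \<le> (\<Sum>s\<in>UNIV. \<Sum>t\<in>UNIV. ((w s)^2 * of_bool (P s t) + (w t)^2 * of_bool (P s t)) / 2)"
  proof (intro sum_mono)
    fix s t
    have "\<bar>w s * w t\<bar> \<le> ((w s)^2 + (w t)^2) / 2"
      using sum_squares_bound[of "\<bar>w s\<bar>" "\<bar>w t\<bar>"] by (simp add: abs_mult)
    then show "\<bar>w s * w t * of_bool (P s t)\<bar> \<le> ((w s)^2 * of_bool (P s t) + (w t)^2 * of_bool (P s t)) / 2"
      by simp
  qed
  also have "\<dots> = (\<Sum>s\<in>UNIV. \<Sum>t\<in>UNIV. (w s)^2 * of_bool (P s t))"
    using swap by (simp add: sum_divide_distrib [symmetric] sum.distrib)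
  finally show ?thesis using half by linarith
qed

context additive_character
begin

lemma CARD_gt_1: "CARD('a) > 1"
  using card_mono[of UNIV "{0, 1::'a}"] by simp

lemma four_neq_0: "(4::'a) \<noteq> 0"
  using two_neq_0 by (metis mult_2 mult_eq_0_iff numeral_Bit0)

lemma abs_quad_char_power: "\<bar>(quad_char (-1::'a) * CARD('a)) ^ D\<bar> = real CARD('a) ^ D"
  using quad_char_cases[of "-1::'a"] by (auto simp: power_abs abs_mult)

section \<open>Deviation bound from extending A to the sphere\<close>

text \<open>The sign condition on \<open>j\<close> enters here. If s^2 = m j with m =
  \<open>normsq u\<close> nonzero, then m and j have the same character and the error term is -q^D
  (q - 1). If m = 0 it is 0 or -q^(D+1). Only the remaining case, of size q^D, can be
  positive.\<close>

lemma card_bisector_le: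
  fixes b b' :: "'a ^ 'n"
  assumes n: "CARD('n) = 2 * D + 1" and neq: "b \<noteq> b'"
    and j: "(quad_char (-1::'a) * CARD('a)) ^ D * quad_char j = - (real CARD('a) ^ D)"
  shows "real CARD('a) * real (card {a. normsq a = j \<and> sqdist a b = sqdist a b'})
    \<le> real CARD('a) ^ (2 * D) + real CARD('a) ^ D"
proof -
  define u where "u = b - b'"
  define s where "s = (normsq b - normsq b') / 2"
  define C where "C = (quad_char (-1::'a) * CARD('a)) ^ D"
  define q where "q = real CARD('a)"
  have q: "q > 1" using CARD_gt_1 by (simp add: q_def)
  have u: "u \<noteq> 0" using neq by (simp add: u_def)
  \<comment> \<open>The term \<open>normsq a\<close> cancels, so the bisector is a hyperplane with
    normal vector \<open>u\<close>.\<close>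
  have "sqdist a b = sqdist a b' \<longleftrightarrow> dotp u a = s" for a
  proof -
    have "sqdist a b = sqdist a b' \<longleftrightarrow> 2 * dotp u a = normsq b - normsq b'"
      by (auto simp: sqdist_eq_normsq normsq_diff u_def dotp_diff algebra_simps)
    then show ?thesis using two_neq_0 by (simp add: s_def eq_divide_eq mult.commute)
  qed
  then have count: "q * real (card {a. normsq a = j \<and> sqdist a b = sqdist a b'})
    = q ^ (2 * D) + C *
      (if normsq u = 0 then if s = 0 then q * quad_char j else 0
       else quad_char (normsq u) * ((if s^2 = normsq u * j then q else 0) - 1))"
    using card_sphere_hyperplane[OF n u, of j s] by (simp add: q_def C_def)
  have Cj: "C * quad_char j = - (q ^ D)" using j by (simp add: C_def q_def)
  have absC: "\<bar>C\<bar> = q ^ D" using abs_quad_char_power by (simp add: C_def q_def)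
  have Q: "q ^ D > 0" using q by simp
  have "j \<noteq> 0" using Cj q by auto
  show ?thesis
  proof (cases "normsq u = 0")
    case True
    have "C * (q * quad_char j) \<le> 0"
      using Cj Q q by (simp add: mult.left_commute[of C])
    then have "C * (q * quad_char j) \<le> q ^ D" using Q by linarith
    then show ?thesis using count True Q by (auto simp: q_def)
  next
    case False
    have "C * (quad_char (normsq u) * ((if s^2 = normsq u * j then q else 0) - 1)) \<le> q ^ D"
    proof (cases "s^2 = normsq u * j")
      case True
      then have "is_square (normsq u * j)" unfolding is_square_def by blast
      then have "quad_char (normsq u) * quad_char j = 1"
        using False \<open>j \<noteq> 0\<close> quad_char_mult[OF two_neq_0, of "normsq u" j] by (simp add: quad_char_def)
      then have "quad_char (normsq u) = quad_char j"
        using quad_char_cases[OF \<open>j \<noteq> 0\<close>] by auto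
      then have "C * (quad_char (normsq u) * (q - 1)) = - (q ^ D * (q - 1))"
        using Cj by (simp add: mult.assoc [symmetric])
      moreover have "0 \<le> q ^ D * (q - 1)" using Q q by simp
      ultimately show ?thesis using True Q by simp
    next
      case False
      have "\<bar>C * quad_char (normsq u)\<bar> \<le> \<bar>C\<bar> * 1"
        unfolding abs_mult by (intro mult_left_mono abs_quad_char_le) simp
      then show ?thesis using False absC by simp
    qed
    then show ?thesis using count False by (simp add: q_def)
  qed
qed

text \<open>Once \<open>A\<close> is enlarged to the sphere, the second moment counts the points of
  the sphere equidistant from \<open>b\<close> and \<open>b'\<close>, which
  \<open>card_bisector_le\<close> controls.\<close>

lemma deviation_le_sphere:
  fixes A B :: "('a ^ 'n) set" and q :: real
  assumes n: "CARD('n) = 2 * D + 1" and A: "A \<subseteq> {x. normsq x = j}"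
    and j: "(quad_char (-1::'a) * CARD('a)) ^ D * quad_char j = - (real CARD('a) ^ D)"
  defines "q \<equiv> real CARD('a)"
  shows "(\<Sum>t\<in>UNIV. (fiber_count (A \<times> B) (\<lambda>(a,b). sqdist a b) t - card (A \<times> B) / q)^2)
    \<le> card A * (card B * q ^ (2 * D) + 2 * q ^ D * (card B)^2 / q)"
proof -
  define S where "S = {x::'a^'n. normsq x = j}"
  define N where "N a t = fiber_count B (sqdist a) t" for a :: "'a^'n" and t
  define c where "c = card B / q"
  have q: "q > 1" using CARD_gt_1 by (simp add: q_def)
  have cardS: "real (card S) = q ^ (2 * D) - q ^ D"
    using card_sphere[OF n, of j] j by (simp add: S_def q_def)
  have dev: "fiber_count (A \<times> B) (\<lambda>(a,b). sqdist a b) t - card (A \<times> B) / q = (\<Sum>a\<in>A. N a t - c)" for t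
    by (simp add: N_def c_def fiber_count_Times sum_subtractf card_cartesian_product)
  have "(\<Sum>t\<in>UNIV. (fiber_count (A \<times> B) (\<lambda>(a,b). sqdist a b) t - card (A \<times> B) / q)^2)
      \<le> (\<Sum>t\<in>UNIV. card A * (\<Sum>a\<in>A. (N a t - c)^2))"
    unfolding dev by (intro sum_mono sum_squared_le_card)
  also have "\<dots> = card A * (\<Sum>a\<in>A. \<Sum>t\<in>UNIV. (N a t - c)^2)"
    by (subst sum.swap) (simp add: sum_distrib_left)
  also have "\<dots> \<le> card A * (\<Sum>a\<in>S. \<Sum>t\<in>UNIV. (N a t - c)^2)"
    using A by (intro mult_left_mono sum_mono2) (auto simp: S_def intro: sum_nonneg)
  also have "(\<Sum>a\<in>S. \<Sum>t\<in>UNIV. (N a t - c)^2) = (\<Sum>a\<in>S. \<Sum>t\<in>UNIV. (N a t)^2) - card S * ((card B)^2 / q)"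
    unfolding N_def c_def q_def by (simp add: sum_fiber_count_deviation_sq sum_subtractf)
  also have "(\<Sum>a\<in>S. \<Sum>t\<in>UNIV. (N a t)^2) = (\<Sum>b\<in>B. \<Sum>b'\<in>B. real (card {a. normsq a = j \<and> sqdist a b' = sqdist a b}))"
  proof -
    have "(\<Sum>a\<in>S. \<Sum>t\<in>UNIV. (N a t)^2) = (\<Sum>a\<in>S. \<Sum>b\<in>B. \<Sum>b'\<in>B. of_bool (sqdist a b' = sqdist a b))"
      by (simp add: N_def sum_fiber_count_sq)
    also have "\<dots> = (\<Sum>b\<in>B. \<Sum>b'\<in>B. \<Sum>a\<in>S. of_bool (sqdist a b' = sqdist a b))"
      by (subst sum.swap) (intro sum.cong refl sum.swap)
    finally show ?thesis
      by (simp add: S_def of_bool_def sum.If_cases Int_def)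
  qed
  also have "\<dots> \<le> (\<Sum>b\<in>B. \<Sum>b'\<in>B. (q ^ (2 * D) + q ^ D) / q + of_bool (b' = b) * real (card S))"
  proof (intro sum_mono)
    fix b b' assume "b \<in> B" "b' \<in> B"
    show "real (card {a. normsq a = j \<and> sqdist a b' = sqdist a b})
      \<le> (q ^ (2 * D) + q ^ D) / q + of_bool (b' = b) * real (card S)"
    proof (cases "b' = b")
      case True
      then show ?thesis using q by (simp add: S_def)
    next
      case False
      then show ?thesis
        using card_bisector_le[OF n False j] q by (simp add: q_def [symmetric] pos_le_divide_eq mult.commute)
    qed
  qed
  also have "\<dots> = (real (card B))^2 * ((q ^ (2 * D) + q ^ D) / q) + real (card B) * real (card S)"
    by (rule sum_sum_diagonal) simp
  \<comment> \<open>The terms of order q^(2D) \<open>(card B)^2\<close> / q cancel. The two errors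
    q^D, one from the bisectors and one from the size of the sphere, account for the factor
    2.\<close>
  also have "(real (card B))^2 * ((q ^ (2 * D) + q ^ D) / q) + real (card B) * real (card S) - card S * ((card B)^2 / q)
      = card B * (q ^ (2 * D) - q ^ D) + 2 * q ^ D * (card B)^2 / q"
    unfolding cardS using q by (simp add: field_simps)
  also have "\<dots> \<le> card B * q ^ (2 * D) + 2 * q ^ D * (card B)^2 / q"
    using q by (simp add: mult_left_mono)
  finally show ?thesis
    by (simp add: mult_left_mono)
qed

section \<open>Deviation bound from extending B to the whole space\<close>

text \<open>The correlation is a quadratic form in \<open>w\<close> whose coefficients count
  intersections of two spheres. Since \<open>w\<close> has sum 0, the constant part of these counts
  drops out and a sparse symmetric kernel remains.\<close>

lemma sum_two_spheres_le:
  fixes a a' :: "'a ^ 'n" and w :: "'a \<Rightarrow> real"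
  assumes n: "CARD('n) = 2 * D + 1" and w: "(\<Sum>t\<in>UNIV. w t) = 0" and neq: "a \<noteq> a'"
  shows "(\<Sum>b\<in>UNIV. w (sqdist a b) * w (sqdist a' b)) \<le> 2 * real CARD('a) ^ D * (\<Sum>t\<in>UNIV. (w t)^2)"
proof -
  define u where "u = a - a'"
  define m where "m = normsq u"
  define C where "C = (quad_char (-1::'a) * CARD('a)) ^ D"
  define q where "q = real CARD('a)"
  define V where "V = (\<Sum>t\<in>UNIV. (w t)^2)"
  define K where "K t t' = real (card {c. normsq c = t \<and> dotp u c = (t + m - t') / 2})" for t t'
  define R where "R t t' = (if m = 0 then if t = t' then q * quad_char t else 0
      else quad_char m * ((if ((t + m - t') / 2)^2 = m * t then q else 0) - 1))" for t t'
  have q: "q > 1" using CARD_gt_1 by (simp add: q_def)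
  have u: "u \<noteq> 0" using neq by (simp add: u_def)
  have V: "V \<ge> 0" by (simp add: V_def sum_nonneg)
  have absC: "\<bar>C\<bar> = q ^ D" using abs_quad_char_power by (simp add: C_def q_def)
  have K: "q * K t t' = q ^ (2 * D) + C * R t t'" for t t'
    using card_sphere_hyperplane[OF n u, of t "(t + m - t') / 2"] two_neq_0
    by (simp add: K_def R_def q_def C_def m_def)
  \<comment> \<open>Subtracting the two sphere equations leaves a hyperplane.\<close>
  have cond: "normsq c = t \<and> normsq (c - u) = t' \<longleftrightarrow> normsq c = t \<and> dotp u c = (t + m - t') / 2" for c t t'
    using two_neq_0 by (auto simp: normsq_diff m_def eq_divide_eq algebra_simps)
  have "(\<Sum>b\<in>UNIV. w (sqdist a b) * w (sqdist a' b)) = (\<Sum>c\<in>UNIV. w (normsq c) * w (normsq (c - u)))"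
    by (rule sum.reindex_bij_witness[of _ "\<lambda>c. a - c" "\<lambda>b. a - b"])
       (auto simp: sqdist_eq_normsq u_def algebra_simps)
  also have "\<dots> = (\<Sum>p\<in>UNIV. w (fst p) * w (snd p) * fiber_count UNIV (\<lambda>c. (normsq c, normsq (c - u))) p)"
    using sum_comp_fiber_count[of UNIV "\<lambda>p. w (fst p) * w (snd p)" "\<lambda>c. (normsq c, normsq (c - u))"]
    by simp
  also have "\<dots> = (\<Sum>t\<in>UNIV. \<Sum>t'\<in>UNIV. w t * w t' * K t t')"
  proof -
    have "fiber_count UNIV (\<lambda>c. (normsq c, normsq (c - u))) p = K (fst p) (snd p)" for p
      unfolding fiber_count_def K_def cond [symmetric]
      by (intro arg_cong[where f = real] arg_cong[where f = card]) (auto simp: prod_eq_iff)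
    then show ?thesis by (simp add: sum.cartesian_product split_def)
  qed
  finally have eq: "(\<Sum>b\<in>UNIV. w (sqdist a b) * w (sqdist a' b)) = (\<Sum>t\<in>UNIV. \<Sum>t'\<in>UNIV. w t * w t' * K t t')" .
  have const: "(\<Sum>t\<in>UNIV. \<Sum>t'\<in>UNIV. w t * w t' * k) = 0" for k
    using w by (simp add: sum_distrib_right [symmetric] sum_distrib_left [symmetric])
  have "q * (\<Sum>t\<in>UNIV. \<Sum>t'\<in>UNIV. w t * w t' * K t t')
      = (\<Sum>t\<in>UNIV. \<Sum>t'\<in>UNIV. w t * w t' * q ^ (2 * D) + C * (w t * w t' * R t t'))"
    unfolding sum_distrib_left by (intro sum.cong refl) (metis K distrib_left mult.left_commute)
  also have "\<dots> = C * (\<Sum>t\<in>UNIV. \<Sum>t'\<in>UNIV. w t * w t' * R t t')"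
    by (simp add: sum.distrib const sum_distrib_left)
  also have "\<dots> \<le> q ^ D * \<bar>\<Sum>t\<in>UNIV. \<Sum>t'\<in>UNIV. w t * w t' * R t t'\<bar>"
    using abs_ge_self[of "C * (\<Sum>t\<in>UNIV. \<Sum>t'\<in>UNIV. w t * w t' * R t t')"]
    by (simp only: abs_mult absC)
  also have "\<bar>\<Sum>t\<in>UNIV. \<Sum>t'\<in>UNIV. w t * w t' * R t t'\<bar> \<le> q * (2 * V)"
  proof (cases "m = 0")
    case True
    \<comment> \<open>For m = 0 the hyperplane offset vanishes exactly when t = t', so the form is
      diagonal.\<close>
    have "(\<Sum>t\<in>UNIV. \<Sum>t'\<in>UNIV. w t * w t' * R t t') = (\<Sum>t\<in>UNIV. q * (quad_char t * (w t)^2))"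
    proof (rule sum.cong [OF refl])
      fix t
      have "w t * w t' * R t t' = (if t = t' then q * (quad_char t * (w t)^2) else 0)" for t'
        by (simp add: R_def True power2_eq_square)
      then show "(\<Sum>t'\<in>UNIV. w t * w t' * R t t') = q * (quad_char t * (w t)^2)" by simp
    qed
    also have "\<bar>\<dots>\<bar> \<le> (\<Sum>t\<in>UNIV. q * (w t)^2)"
    proof (intro order.trans[OF sum_abs] sum_mono)
      fix t
      show "\<bar>q * (quad_char t * (w t)^2)\<bar> \<le> q * (w t)^2"
        using q abs_quad_char_le[of t] by (simp add: abs_mult mult_left_le_one_le)
    qed
    also have "\<dots> = q * V" by (simp add: V_def sum_distrib_left)
    finally show ?thesis using V q by (smt (verit) mult_left_mono)
  next
    case False
    define P where "P t t' \<longleftrightarrow> ((t + m - t') / 2)^2 = m * t" for t t'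
    have "w t * w t' * R t t' = (quad_char m * q) * (w t * w t' * of_bool (P t t')) + w t * w t' * (- quad_char m)" for t t'
      using False by (simp add: R_def P_def algebra_simps)
    then have "(\<Sum>t\<in>UNIV. \<Sum>t'\<in>UNIV. w t * w t' * R t t')
        = quad_char m * q * (\<Sum>t\<in>UNIV. \<Sum>t'\<in>UNIV. w t * w t' * of_bool (P t t'))"
      using const[of "- quad_char m"] by (simp only: sum.distrib sum_distrib_left [symmetric])
    then have "\<bar>\<Sum>t\<in>UNIV. \<Sum>t'\<in>UNIV. w t * w t' * R t t'\<bar>
        = q * \<bar>\<Sum>t\<in>UNIV. \<Sum>t'\<in>UNIV. w t * w t' * of_bool (P t t')\<bar>"
      using quad_char_cases[OF False] q by (auto simp: abs_mult)
    also have "\<dots> \<le> q * (2 * V)"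
      unfolding V_def
    proof (intro mult_left_mono sum_symmetric_kernel_le)
      fix s t
      \<comment> \<open>Expanding the square shows that the condition is symmetric in
        \<open>s\<close> and \<open>t\<close>, which its definition hides.\<close>
      have P_iff: "P s t \<longleftrightarrow> s^2 + t^2 + m^2 - 2 * s * t - 2 * m * s - 2 * m * t = 0" for s t
      proof -
        have "P s t \<longleftrightarrow> (s + m - t)^2 = 4 * (m * s)"
          using four_neq_0 by (simp add: P_def power_divide divide_eq_eq mult.commute)
        also have "\<dots> \<longleftrightarrow> (s + m - t)^2 - 4 * (m * s) = 0" by simp
        also have "(s + m - t)^2 - 4 * (m * s) = s^2 + t^2 + m^2 - 2 * s * t - 2 * m * s - 2 * m * t"
          by (simp add: power2_eq_square algebra_simps)
        finally show ?thesis .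
      qed
      show "P s t \<Longrightarrow> P t s"
        unfolding P_iff by (simp add: algebra_simps)
      \<comment> \<open>For given \<open>s\<close>, each such \<open>t\<close> is determined by (s +
        m - t) / 2, a square root of m s.\<close>
      have "card {t. P s t} \<le> card {x. x^2 = m * s}"
        by (rule card_inj_on_le[of "\<lambda>t. (s + m - t) / 2"]) (use two_neq_0 in \<open>auto simp: P_def inj_on_def\<close>)
      then show "real (card {t. P s t}) \<le> 2"
        using card_square_roots[OF two_neq_0, of "m * s"] abs_quad_char_le[of "m * s"] by linarith
    qed (use q in simp)
    finally show ?thesis .
  qed
  finally have "q * (\<Sum>t\<in>UNIV. \<Sum>t'\<in>UNIV. w t * w t' * K t t') \<le> q * (2 * q ^ D * V)"
    using q by (simp add: mult_left_mono mult_ac)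
  then show ?thesis
    using q unfolding eq by (simp add: q_def V_def)
qed

lemma sum_sphere_sq_le:
  fixes a :: "'a ^ 'n" and w :: "'a \<Rightarrow> real"
  assumes n: "CARD('n) = 2 * D + 1"
  shows "(\<Sum>b\<in>UNIV. (w (sqdist a b))^2)
    \<le> (real CARD('a) ^ (2 * D) + real CARD('a) ^ D) * (\<Sum>t\<in>UNIV. (w t)^2)"
proof -
  have "(\<Sum>b\<in>UNIV. (w (sqdist a b))^2) = (\<Sum>c\<in>UNIV. (w (normsq (c::'a^'n)))^2)"
    by (rule sum.reindex_bij_witness[of _ "\<lambda>c. a - c" "\<lambda>b. a - b"]) (auto simp: sqdist_eq_normsq)
  also have "\<dots> = (\<Sum>t\<in>UNIV. (w t)^2 * real (card {c::'a^'n. normsq c = t}))"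
    using sum_comp_fiber_count[of UNIV "\<lambda>t. (w t)^2" "normsq :: 'a^'n \<Rightarrow> 'a"]
    by (simp add: fiber_count_def)
  also have "\<dots> \<le> (\<Sum>t\<in>UNIV. (w t)^2 * (real CARD('a) ^ (2 * D) + real CARD('a) ^ D))"
  proof (intro sum_mono mult_left_mono)
    fix t :: 'a
    have "\<bar>(quad_char (-1::'a) * CARD('a)) ^ D * quad_char t\<bar> \<le> real CARD('a) ^ D * 1"
      unfolding abs_mult abs_quad_char_power by (intro mult_left_mono abs_quad_char_le) simp
    then show "real (card {c::'a^'n. normsq c = t}) \<le> real CARD('a) ^ (2 * D) + real CARD('a) ^ D"
      unfolding card_sphere[OF n] by linarith
  qed simp
  finally show ?thesis by (subst mult.commute) (simp only: sum_distrib_right)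
qed

text \<open>A duality argument: V is the sum of \<open>w\<close> over the distances of all pairs,
  and Cauchy-Schwarz in \<open>b\<close> bounds V^2 by a multiple of V.\<close>

lemma deviation_le_space:
  fixes A B :: "('a ^ 'n) set" and q :: real
  assumes n: "CARD('n) = 2 * D + 1"
  defines "q \<equiv> real CARD('a)"
  shows "(\<Sum>t\<in>UNIV. (fiber_count (A \<times> B) (\<lambda>(a,b). sqdist a b) t - card (A \<times> B) / q)^2)
    \<le> card B * (card A * q ^ (2 * D) + 2 * q ^ D * (card A)^2)"
proof -
  define w where "w t = fiber_count (A \<times> B) (\<lambda>(a,b). sqdist a b) t - card (A \<times> B) / q" for t
  define V where "V = (\<Sum>t\<in>UNIV. (w t)^2)"
  have q: "q > 1" using CARD_gt_1 by (simp add: q_def)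
  have V: "V \<ge> 0" by (simp add: V_def sum_nonneg)
  have w: "(\<Sum>t\<in>UNIV. w t) = 0"
    using q by (simp add: w_def sum_subtractf sum_fiber_count q_def)
  \<comment> \<open>One factor \<open>w t\<close> is expanded by its definition; the mean
    contributes nothing because \<open>w\<close> sums to 0.\<close>
  have "V = (\<Sum>t\<in>UNIV. w t * fiber_count (A \<times> B) (\<lambda>(a,b). sqdist a b) t) - (\<Sum>t\<in>UNIV. w t) * (card (A \<times> B) / q)"
    unfolding V_def sum_distrib_right sum_subtractf [symmetric]
    by (intro sum.cong refl) (simp add: w_def power2_eq_square algebra_simps)
  also have "\<dots> = (\<Sum>p\<in>A \<times> B. w (case p of (a,b) \<Rightarrow> sqdist a b))"
    by (simp add: w sum_comp_fiber_count)
  also have "\<dots> = (\<Sum>b\<in>B. \<Sum>a\<in>A. w (sqdist a b))"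
    by (subst sum.swap) (simp add: sum.cartesian_product split_def)
  finally have V_eq: "V = (\<Sum>b\<in>B. \<Sum>a\<in>A. w (sqdist a b))" .
  have "V^2 \<le> card B * (\<Sum>b\<in>B. (\<Sum>a\<in>A. w (sqdist a b))^2)"
    unfolding V_eq by (rule sum_squared_le_card)
  also have "\<dots> \<le> card B * (\<Sum>b\<in>UNIV. (\<Sum>a\<in>A. w (sqdist a b))^2)"
    by (intro mult_left_mono sum_mono2) auto
  finally have V_le: "V^2 \<le> card B * (\<Sum>b\<in>UNIV. (\<Sum>a\<in>A. w (sqdist a b))^2)" .
  have "(\<Sum>b\<in>UNIV. (\<Sum>a\<in>A. w (sqdist a b))^2)
      = (\<Sum>b\<in>UNIV. \<Sum>a\<in>A. \<Sum>a'\<in>A. w (sqdist a b) * w (sqdist a' b))"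
    by (simp add: power2_eq_square sum_product)
  also have "\<dots> = (\<Sum>a\<in>A. \<Sum>a'\<in>A. \<Sum>b\<in>UNIV. w (sqdist a b) * w (sqdist a' b))"
    by (subst sum.swap) (intro sum.cong refl sum.swap)
  also have "\<dots> \<le> (\<Sum>a\<in>A. \<Sum>a'\<in>A. 2 * q ^ D * V + of_bool (a' = a) * (q ^ (2 * D) * V))"
  proof (intro sum_mono)
    fix a a' assume "a \<in> A" "a' \<in> A"
    show "(\<Sum>b\<in>UNIV. w (sqdist a b) * w (sqdist a' b)) \<le> 2 * q ^ D * V + of_bool (a' = a) * (q ^ (2 * D) * V)"
    proof (cases "a' = a")
      case True
      have "(\<Sum>b\<in>UNIV. w (sqdist a b) * w (sqdist a' b)) \<le> (q ^ (2 * D) + q ^ D) * V"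
        using sum_sphere_sq_le[OF n, of w a] by (simp add: True q_def V_def power2_eq_square)
      \<comment> \<open>The surplus q^D V on the diagonal is absorbed into the uniform term.\<close>
      also have "\<dots> \<le> 2 * q ^ D * V + q ^ (2 * D) * V"
        using V q by (simp add: distrib_right)
      finally show ?thesis using True by simp
    next
      case False
      then show ?thesis
        using sum_two_spheres_le[OF n w, of a a'] by (simp add: q_def V_def)
    qed
  qed
  also have "\<dots> = ((card A)^2 * (2 * q ^ D) + card A * q ^ (2 * D)) * V"
    by (subst sum_sum_diagonal) (simp_all add: algebra_simps)
  finally have "card B * (\<Sum>b\<in>UNIV. (\<Sum>a\<in>A. w (sqdist a b))^2)
      \<le> card B * (((card A)^2 * (2 * q ^ D) + card A * q ^ (2 * D)) * V)"
    by (rule mult_left_mono) simp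
  with V_le have "V * V \<le> (card B * (card A * q ^ (2 * D) + 2 * q ^ D * (card A)^2)) * V"
    by (simp add: power2_eq_square algebra_simps)
  moreover have "0 \<le> card B * (card A * q ^ (2 * D) + 2 * q ^ D * (card A)^2)"
    using q by simp
  ultimately have "V \<le> card B * (card A * q ^ (2 * D) + 2 * q ^ D * (card A)^2)"
    using V by (cases "V = 0") auto
  then show ?thesis by (simp add: V_def w_def)
qed

section \<open>Lower bound for the number of distances\<close>

lemma card_dist_set_ge:
  fixes A B :: "('a ^ 'n) set"
  assumes n: "CARD('n) = 2 * D + 1" and A: "A \<subseteq> {x. normsq x = j}"
    and j: "(quad_char (-1::'a) * CARD('a)) ^ D * quad_char j = - (real CARD('a) ^ D)"
    and large: "card A * card B \<ge> 4 * CARD('a) ^ CARD('n)"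
  shows "real (card (dist_set A B)) \<ge> 4 * real CARD('a) / 9"
proof -
  define q where "q = real CARD('a)"
  define Q where "Q = q ^ D"
  define N where "N = real (card A) * real (card B)"
  define f where "f = (\<lambda>(a::'a^'n,b). sqdist a b)"
  define \<nu> where "\<nu> = fiber_count (A \<times> B) f"
  define V where "V = (\<Sum>t\<in>UNIV. (\<nu> t - N / q)^2)"
  have q: "q > 1" using CARD_gt_1 by (simp add: q_def)
  have Q: "Q > 0" using q by (simp add: Q_def)
  have "real (4 * CARD('a) ^ CARD('n)) \<le> real (card A * card B)"
    using large by (simp only: of_nat_le_iff)
  then have N: "4 * q * Q^2 \<le> N"
    by (simp add: N_def q_def Q_def n power_mult [symmetric] mult.commute mult.left_commute)
  then have Npos: "N > 0" using q Q by (smt (verit) mult_pos_pos zero_less_power)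
  have Q2: "q ^ (2 * D) = Q^2" by (simp add: Q_def power_mult [symmetric] mult.commute)
  have V1: "V \<le> N * Q^2 + 2 * Q * N * card B / q"
  proof -
    have "V \<le> card A * (card B * q ^ (2 * D) + 2 * q ^ D * (card B)^2 / q)"
      using deviation_le_sphere[OF n A j, of B]
      by (simp add: V_def \<nu>_def f_def N_def q_def card_cartesian_product)
    also have "\<dots> = N * Q^2 + 2 * Q * N * card B / q"
      unfolding Q2 Q_def [symmetric] N_def by (simp add: power2_eq_square algebra_simps)
    finally show ?thesis .
  qed
  have V2: "V \<le> N * Q^2 + 2 * Q * N * card A"
  proof -
    have "V \<le> card B * (card A * q ^ (2 * D) + 2 * q ^ D * (card A)^2)"
      using deviation_le_space[OF n, of A B]
      by (simp add: V_def \<nu>_def f_def N_def q_def card_cartesian_product)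
    also have "\<dots> = N * Q^2 + 2 * Q * N * card A"
      unfolding Q2 Q_def [symmetric] N_def by (simp add: power2_eq_square algebra_simps)
    finally show ?thesis .
  qed
  have first: "N * Q^2 \<le> N * (N / (4 * q))"
    using N Npos q by (intro mult_left_mono) (simp_all add: pos_le_divide_eq mult.commute mult.left_commute)
  \<comment> \<open>The threshold 2Q balances the two bounds: either \<open>A\<close> has at least
    2Q points and \<open>V1\<close> suffices, or N >= 4 q Q^2 forces \<open>B\<close> to have at
    least 2Qq points and \<open>V2\<close> suffices.\<close>
  have "V \<le> N * (N / (4 * q)) + N * (N / q)"
  proof (cases "2 * Q \<le> card A")
    case True
    have "2 * Q * N * card B / q = N * (2 * Q * card B / q)" by simp
    also have "\<dots> \<le> N * (real (card A) * real (card B) / q)"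
      using Npos q mult_right_mono[OF True, of "card B"] by (intro mult_left_mono divide_right_mono) auto
    finally have "2 * Q * N * card B / q \<le> N * (N / q)" by (simp only: N_def)
    then show ?thesis using V1 first by linarith
  next
    case False
    have "2 * Q * (2 * Q * q) \<le> N" using N by (simp add: power2_eq_square mult_ac)
    also have "N \<le> 2 * Q * card B"
      unfolding N_def using False by (intro mult_right_mono) auto
    finally have "2 * Q * q \<le> card B" using Q by simp
    then have "2 * Q \<le> card B / q" using q by (simp add: pos_le_divide_eq)
    then have "2 * Q * N * card A \<le> (card B / q) * N * card A"
      using Npos by (intro mult_right_mono) auto
    also have "\<dots> = N * (N / q)" by (simp add: N_def)
    finally show ?thesis using V2 first by linarith
  qed
  then have V: "V \<le> 5 / 4 * (N^2 / q)" using q by (simp add: power2_eq_square field_simps)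
  have sq: "(\<Sum>t\<in>UNIV. (\<nu> t)^2) = V + N^2 / q"
    using sum_fiber_count_deviation_sq[of "A \<times> B" f]
    by (simp add: V_def \<nu>_def N_def q_def card_cartesian_product)
  have "\<nu> t = 0" if "t \<notin> dist_set A B" for t
  proof -
    have "{p \<in> A \<times> B. f p = t} = {}" using that by (auto simp: dist_set_def f_def)
    then show ?thesis by (simp add: \<nu>_def fiber_count_def)
  qed
  then have "(\<Sum>t\<in>dist_set A B. \<nu> t) = (\<Sum>t\<in>UNIV. \<nu> t)"
    by (intro sum.mono_neutral_left) auto
  then have "N = (\<Sum>t\<in>dist_set A B. \<nu> t)"
    by (simp add: \<nu>_def sum_fiber_count N_def card_cartesian_product)
  then have "N^2 \<le> card (dist_set A B) * (\<Sum>t\<in>dist_set A B. (\<nu> t)^2)"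
    using sum_squared_le_card[of \<nu> "dist_set A B"] by simp
  also have "\<dots> \<le> card (dist_set A B) * (\<Sum>t\<in>UNIV. (\<nu> t)^2)"
    by (intro mult_left_mono sum_mono2) auto
  \<comment> \<open>The constant is 9/4 = 5/4 + 1: the deviation plus the contribution of the
    mean.\<close>
  also have "\<dots> \<le> card (dist_set A B) * (9 / 4 * (N^2 / q))"
    unfolding sq using V by (intro mult_left_mono) auto
  finally have "N^2 * 1 \<le> N^2 * (card (dist_set A B) * 9 / (4 * q))"
    by (simp add: field_simps)
  then have "1 \<le> card (dist_set A B) * 9 / (4 * q)"
    using Npos by (subst (asm) mult_le_cancel_left_pos) auto
  then show ?thesis using q by (simp add: q_def pos_le_divide_eq)
qed

end

theorem theorem1p19:
  fixes j :: "'a::{field,finite}"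
    and A B :: "('a ^ 'n) set"
  assumes q_pp: "\<exists>p m. prime p \<and> odd p \<and> m > 0 \<and> CARD('a) = p ^ m"
    and j_nz: "j \<noteq> 0"
    and A_sub: "A \<subseteq> sphere_ff j"
  shows
    "(is_square j \<and> (\<exists>k::nat. k > 0 \<and> CARD('n) = 4*k - 1) \<and> CARD('a) mod 4 = 3
        \<and> card A * card B \<ge> 4 * CARD('a) ^ CARD('n)
       \<longrightarrow> real (card (dist_set A B)) \<ge> real (CARD('a)) / 4)
     \<and>
     (\<not> is_square j \<and> ((\<exists>k::nat. k > 0 \<and> CARD('n) = 4*k + 1)
          \<or> ((\<exists>k::nat. k > 0 \<and> CARD('n) = 4*k - 1) \<and> CARD('a) mod 4 = 1))
        \<and> card A * card B \<ge> 4 * CARD('a) ^ CARD('n)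
       \<longrightarrow> real (card (dist_set A B)) \<ge> real (CARD('a)) / 4)"
proof -
  from q_pp obtain p m where pm: "prime p" "odd p" "m > 0" "CARD('a) = p ^ m" by blast
  then have odd_q: "odd CARD('a)" by simp
  have two: "(2::'a) \<noteq> 0"
  proof
    \<comment> \<open>The field has odd order, so 2 = 0 would turn the image of that order, which is
      0, into 1.\<close>
    assume "(2::'a) = 0"
    moreover obtain k where "CARD('a) = 2 * k + 1" using odd_q by (elim oddE)
    ultimately have "of_nat CARD('a) = (1::'a)" by simp
    then show False by (simp add: of_nat_CARD_eq_0)
  qed
  from ex_additive_character[OF pm(1,3,4)] obtain \<psi> :: "'a \<Rightarrow> complex"
    where "additive_character \<psi>"
    using two by (auto simp: additive_character_def)
  then interpret additive_character \<psi> .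
  have bound: "real (card (dist_set A B)) \<ge> real (CARD('a)) / 4"
    if n: "CARD('n) = 2 * D + 1" and sign: "quad_char (-1::'a) ^ D * quad_char j = -1"
      and large: "card A * card B \<ge> 4 * CARD('a) ^ CARD('n)" for D
  proof -
    have "(quad_char (-1::'a) * CARD('a)) ^ D * quad_char j
        = (quad_char (-1::'a) ^ D * quad_char j) * real CARD('a) ^ D"
      by (simp add: power_mult_distrib)
    then have "(quad_char (-1::'a) * CARD('a)) ^ D * quad_char j = - (real CARD('a) ^ D)"
      by (simp add: sign)
    from card_dist_set_ge[OF n _ this large] A_sub
    have "4 * real CARD('a) / 9 \<le> real (card (dist_set A B))"
      by (simp add: sphere_ff_eq_normsq)
    then show ?thesis by simp
  qed
  \<comment> \<open>D = 2k - 1 is odd, so in dimension 4k - 1 the sign depends on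
    \<open>quad_char (-1)\<close>, that is, on q modulo 4.\<close>
  have minus: "\<exists>D. odd D \<and> CARD('n) = 2 * D + 1" if "k > 0" "CARD('n) = 4 * k - 1" for k
    using that by (intro exI[of _ "2 * k - 1"]) auto
  have q1: "quad_char (-1::'a) = (if CARD('a) mod 4 = 1 then 1 else -1)"
    by (rule quad_char_uminus_1[OF two odd_q])
  have j_sq: "quad_char j = 1" if "is_square j" using that j_nz by (simp add: quad_char_def)
  have j_nsq: "quad_char j = -1" if "\<not> is_square j" using that j_nz by (simp add: quad_char_def)
  have quad_char_minus_1_sq: "quad_char (-1::'a) ^ 2 = 1" by (simp add: q1)
  show ?thesis
  proof (intro conjI impI; elim conjE exE disjE)
    fix k assume "is_square j" "k > 0" "CARD('n) = 4 * k - 1" "CARD('a) mod 4 = 3"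
      and large: "4 * CARD('a) ^ CARD('n) \<le> card A * card B"
    moreover from minus[OF this(2,3)] obtain D where "odd D" "CARD('n) = 2 * D + 1" by blast
    ultimately show "real CARD('a) / 4 \<le> real (card (dist_set A B))"
      by (intro bound[of D]) (auto simp: j_sq q1)
  next
    \<comment> \<open>D = 2k is even, so \<open>quad_char (-1) ^ D\<close> is 1 for every odd q and
      the nonsquare \<open>j\<close> alone supplies the sign.\<close>
    fix k assume "\<not> is_square j" "CARD('n) = 4 * k + 1"
      and large: "4 * CARD('a) ^ CARD('n) \<le> card A * card B"
    then show "real CARD('a) / 4 \<le> real (card (dist_set A B))"
     
      by (intro bound[of "2 * k"]) (auto simp: j_nsq power_mult quad_char_minus_1_sq)
  next
    fix k assume "\<not> is_square j" "k > 0" "CARD('n) = 4 * k - 1" "CARD('a) mod 4 = 1"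
      and large: "4 * CARD('a) ^ CARD('n) \<le> card A * card B"
    moreover from minus[OF this(2,3)] obtain D where "CARD('n) = 2 * D + 1" by blast
    ultimately show "real CARD('a) / 4 \<le> real (card (dist_set A B))"
      by (intro bound[of D]) (auto simp: j_nsq q1)
  qed
qed

end
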